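(* Let $(A,\cdot)$ be a left-symmetric algebra and let $(A^*,\circ)$ be a left-symmetric algebra structure on its dual space $A^*$. Then the following conditions are equivalent: (1) the bracket on $A\oplus A^*$ $$[x+a^*,y+b^*]=[x,y]+L^*_\circ(a^* )y-L^*_\circ(b^* )x+[a^*,b^*]+L^*_\cdot(x)b^*-L^*_\cdot(y)a^*\qquad(x,y\in A,\ a^*,b^*\in A^* )$$ is a Lie bracket and, with it, $(A\oplus A^*,\mathcal G(A),\mathcal G(A^* ),\omega_p)$ is a parakähler Lie algebra, where $\omega_p(x+a^*,y+b^* )=\langle a^*,y\rangle-\langle x,b^*\rangle$; (2) $(\mathcal G(A),\mathcal G(A^* ),L^*_\cdot,L^*_\circ)$ is a matched pair of Lie algebras; (3) $(A,A^*,\mathrm{ad}^*_\cdot,-R^*_\cdot,\mathrm{ad}^*_\circ,-R^*_\circ)$ is a matched pair of left-symmetric algebras; (4) $(A,A^* )$ is a left-symmetric bialgebra.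
   Context: All algebras are finite-dimensional over a field $\mathbf F$. A left-symmetric algebra is a vector space $A$ with a bilinear product satisfying $(xy)z-x(yz)=(yx)z-y(xz)$. Its sub-adjacent Lie algebra $\mathcal G(A)$ is $A$ with $[x,y]=xy-yx$. Write $L(x)y=xy$, $R(x)y=yx$, $\mathrm{ad}=L-R$; subscripts $\cdot$, $\circ$ indicate the product used. For a linear map $\rho:A\to gl(V)$, define $\rho^*:A\to gl(V^* )$ by $\langle\rho^*(x)u^*,v\rangle=-\langle u^*,\rho(x)v\rangle$; this gives $L^*,R^*,\mathrm{ad}^*=L^*-R^*$. For $(A^*,\circ)$ these act on $A^{**}=A$. Parakähler Lie algebra $(\mathcal G,\mathcal G^+,\mathcal G^-,\omega)$: a Lie algebra $\mathcal G$ with a nondegenerate skew-symmetric bilinear form $\omega$ satisfying $\omega([x,y],z)+\omega([y,z],x)+\omega([z,x],y)=0$, and Lie subalgebras $\mathcal G^\pm$ that are Lagrangian (equal to their $\omega$-orthogonal) with $\mathcal G=\mathcal G^+\oplus\mathcal G^-$ as vector spaces. Matched pair of Lie algebras $(\mathcal G,\mathcal H,\rho,\mu)$: Lie algebras $\mathcal G,\mathcal H$ and representations $\rho:\mathcal G\to gl(\mathcal H)$, $\mu:\mathcal H\to gl(\mathcal G)$ with $\rho(x)[a,b]-[\rho(x)a,b]-[a,\rho(x)b]+\rho(\mu(a)x)b-\rho(\mu(b)x)a=0$ and $\mu(a)[x,y]-[\mu(a)x,y]-[x,\mu(a)y]+\mu(\rho(x)a)y-\mu(\rho(y)a)x=0$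 for all $x,y\in\mathcal G$, $a,b\in\mathcal H$. Bimodule of a left-symmetric algebra $A$: a vector space $V$ with linear maps $S,T:A\to gl(V)$ such that $S(x)S(y)-S(xy)=S(y)S(x)-S(yx)$ and $S(x)T(y)-T(y)S(x)=T(xy)-T(y)T(x)$. Matched pair of left-symmetric algebras $(A,B,l_A,r_A,l_B,r_B)$, for left-symmetric algebras $(A,\cdot)$, $(B,\circ)$: $(l_A,r_A)$ is a bimodule of $A$ on $B$, $(l_B,r_B)$ is a bimodule of $B$ on $A$, and for all $x,y\in A$, $a,b\in B$: $r_A(x)[a,b]=r_A(l_B(b)x)a-r_A(l_B(a)x)b+a\circ(r_A(x)b)-b\circ(r_A(x)a)$; $l_A(x)(a\circ b)=-l_A(l_B(a)x-r_B(a)x)b+(l_A(x)a-r_A(x)a)\circ b+r_A(r_B(b)x)a+a\circ(l_A(x)b)$; $r_B(a)[x,y]=r_B(l_A(y)a)x-r_B(l_A(x)a)y+x\cdot(r_B(a)y)-y\cdot(r_B(a)x)$; $l_B(a)(x\cdot y)=-l_B(l_A(x)a-r_A(x)a)y+(l_B(a)x-r_B(a)x)\cdot y+r_B(r_A(y)a)x+x\cdot(l_B(a)y)$. Left-symmetric bialgebra $(A,A^* )$: left-symmetric products on $A$ and on $A^*$ such that, if $\alpha:A\to A\otimes A$ is the dual map of the product $A^*\otimes A^*\to A^*$ and $\beta:A^*\to A^*\otimes A^*$ is the dual map of the product $A\otimes A\to A$, then $\alpha$ is a 1-cocycle of $\mathcal G(A)$ associated to the representation $L\otimes1+1\otimes\mathrm{ad}$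 on $A\otimes A$, and $\beta$ is a 1-cocycle of $\mathcal G(A^* )$ associated to $L\otimes1+1\otimes\mathrm{ad}$ on $A^*\otimes A^*$. A 1-cocycle $\delta$ associated to a representation $\rho$ satisfies $\delta([x,y])=\rho(x)\delta(y)-\rho(y)\delta(x)$. *)

theory Defs
  imports Complex_Main "HOL-Library.Function_Algebras" "HOL-Library.Product_Plus"
begin

text \<open>
  A vector space is given by a scaling operation on a type together with a subspace of that type
  as carrier. The ambient space \<open>A\<close> is a whole type; its dual is a proper subspace of
  the function type \<open>'a \<Rightarrow> 'f\<close>, so every structure below is relativised to a carrier.
\<close>

subsection \<open>Linear and bilinear maps between carriers\<close>

definition linear_on ::
  "('f \<Rightarrow> 'u \<Rightarrow> 'u) \<Rightarrow> 'u set \<Rightarrow> ('f \<Rightarrow> 'v \<Rightarrow> 'v) \<Rightarrow> 'v set \<Rightarrow> ('u::plus \<Rightarrow> 'v::plus) \<Rightarrow> bool" where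
  "linear_on s U t V h \<longleftrightarrow>
     (\<forall>x\<in>U. h x \<in> V) \<and>
     (\<forall>x\<in>U. \<forall>y\<in>U. h (x + y) = h x + h y) \<and>
     (\<forall>c. \<forall>x\<in>U. h (s c x) = t c (h x))"

definition bilinear_on ::
  "('f \<Rightarrow> 'u \<Rightarrow> 'u) \<Rightarrow> 'u set \<Rightarrow> ('f \<Rightarrow> 'v \<Rightarrow> 'v) \<Rightarrow> 'v set \<Rightarrow> ('f \<Rightarrow> 'w \<Rightarrow> 'w) \<Rightarrow> 'w set \<Rightarrow>
     ('u::plus \<Rightarrow> 'v::plus \<Rightarrow> 'w::plus) \<Rightarrow> bool" where
  "bilinear_on s U t V r W b \<longleftrightarrow>
     (\<forall>x\<in>U. linear_on t V r W (\<lambda>y. b x y)) \<and> (\<forall>y\<in>V. linear_on s U r W (\<lambda>x. b x y))"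

locale vector_space_on = vector_space scale
  for scale :: "'f::field \<Rightarrow> 'v::ab_group_add \<Rightarrow> 'v" +
  fixes V :: "'v set"
  assumes subspace_carrier: "subspace V"

subsection \<open>Left-symmetric algebras and Lie algebras\<close>

locale left_symmetric_algebra = vector_space_on scale A
  for scale :: "'f::field \<Rightarrow> 'v::ab_group_add \<Rightarrow> 'v" and A :: "'v set" +
  fixes mult :: "'v \<Rightarrow> 'v \<Rightarrow> 'v"
  assumes mult_bilinear: "bilinear_on scale A scale A scale A mult"
    and left_symmetric: "\<lbrakk>x \<in> A; y \<in> A; z \<in> A\<rbrakk> \<Longrightarrow>
      mult (mult x y) z - mult x (mult y z) = mult (mult y x) z - mult y (mult x z)"

locale lie_algebra = vector_space_on scale G
  for scale :: "'f::field \<Rightarrow> 'v::ab_group_add \<Rightarrow> 'v" and G :: "'v set" +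
  fixes bracket :: "'v \<Rightarrow> 'v \<Rightarrow> 'v"
  assumes bracket_bilinear: "bilinear_on scale G scale G scale G bracket"
    and bracket_alternating: "x \<in> G \<Longrightarrow> bracket x x = 0"
    and jacobi: "\<lbrakk>x \<in> G; y \<in> G; z \<in> G\<rbrakk> \<Longrightarrow>
      bracket (bracket x y) z + bracket (bracket y z) x + bracket (bracket z x) y = 0"

definition L_op :: "('v \<Rightarrow> 'v \<Rightarrow> 'v) \<Rightarrow> 'v \<Rightarrow> 'v \<Rightarrow> 'v" where
  "L_op m x y = m x y"

definition R_op :: "('v \<Rightarrow> 'v \<Rightarrow> 'v) \<Rightarrow> 'v \<Rightarrow> 'v \<Rightarrow> 'v" where
  "R_op m x y = m y x"

definition ad_op :: "('v::ab_group_add \<Rightarrow> 'v \<Rightarrow> 'v) \<Rightarrow> 'v \<Rightarrow> 'v \<Rightarrow> 'v" where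
  "ad_op m x y = L_op m x y - R_op m x y"

definition comm_bracket :: "('v::ab_group_add \<Rightarrow> 'v \<Rightarrow> 'v) \<Rightarrow> 'v \<Rightarrow> 'v \<Rightarrow> 'v" where
  "comm_bracket m x y = m x y - m y x"

text \<open>
  A linear map \<open>\<rho> : G \<rightarrow> gl(V)\<close> is encoded by its uncurrying, a bilinear map
  \<open>G \<times> V \<rightarrow> V\<close>.
\<close>

locale lie_representation =
  lie_algebra s G bracket + V: vector_space_on t V
  for s :: "'f::field \<Rightarrow> 'g::ab_group_add \<Rightarrow> 'g" and G :: "'g set" and bracket
    and t :: "'f \<Rightarrow> 'v::ab_group_add \<Rightarrow> 'v" and V :: "'v set" +
  fixes \<rho> :: "'g \<Rightarrow> 'v \<Rightarrow> 'v"
  assumes rep_bilinear: "bilinear_on s G t V t V \<rho>"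
    and rep_bracket: "\<lbrakk>x \<in> G; y \<in> G; v \<in> V\<rbrakk> \<Longrightarrow>
      \<rho> (bracket x y) v = \<rho> x (\<rho> y v) - \<rho> y (\<rho> x v)"

locale lie_cocycle = lie_representation s G bracket t V \<rho>
  for s :: "'f::field \<Rightarrow> 'g::ab_group_add \<Rightarrow> 'g" and G :: "'g set" and bracket
    and t :: "'f \<Rightarrow> 'v::ab_group_add \<Rightarrow> 'v" and V :: "'v set" and \<rho> +
  fixes \<delta> :: "'g \<Rightarrow> 'v"
  assumes cocycle_linear: "linear_on s G t V \<delta>"
    and cocycle: "\<lbrakk>x \<in> G; y \<in> G\<rbrakk> \<Longrightarrow> \<delta> (bracket x y) = \<rho> x (\<delta> y) - \<rho> y (\<delta> x)"

locale lie_matched_pair =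
  G: lie_representation s G bG t H \<rho> + H: lie_representation t H bH s G \<mu>
  for s :: "'f::field \<Rightarrow> 'g::ab_group_add \<Rightarrow> 'g" and G :: "'g set" and bG
    and t :: "'f \<Rightarrow> 'h::ab_group_add \<Rightarrow> 'h" and H :: "'h set" and bH
    and \<rho> :: "'g \<Rightarrow> 'h \<Rightarrow> 'h" and \<mu> :: "'h \<Rightarrow> 'g \<Rightarrow> 'g" +
  assumes compat_\<rho>: "\<lbrakk>x \<in> G; a \<in> H; b \<in> H\<rbrakk> \<Longrightarrow>
      \<rho> x (bH a b) - bH (\<rho> x a) b - bH a (\<rho> x b) + \<rho> (\<mu> a x) b - \<rho> (\<mu> b x) a = 0"
    and compat_\<mu>: "\<lbrakk>a \<in> H; x \<in> G; y \<in> G\<rbrakk> \<Longrightarrow>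
      \<mu> a (bG x y) - bG (\<mu> a x) y - bG x (\<mu> a y) + \<mu> (\<rho> x a) y - \<mu> (\<rho> y a) x = 0"

subsection \<open>Matched pairs of left-symmetric algebras\<close>

locale lsa_bimodule =
  left_symmetric_algebra s A mult + V: vector_space_on t V
  for s :: "'f::field \<Rightarrow> 'a::ab_group_add \<Rightarrow> 'a" and A :: "'a set" and mult
    and t :: "'f \<Rightarrow> 'v::ab_group_add \<Rightarrow> 'v" and V :: "'v set" +
  fixes S T :: "'a \<Rightarrow> 'v \<Rightarrow> 'v"
  assumes S_bilinear: "bilinear_on s A t V t V S"
    and T_bilinear: "bilinear_on s A t V t V T"
    and bimodule_S: "\<lbrakk>x \<in> A; y \<in> A; v \<in> V\<rbrakk> \<Longrightarrow>
      S x (S y v) - S (mult x y) v = S y (S x v) - S (mult y x) v"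
    and bimodule_T: "\<lbrakk>x \<in> A; y \<in> A; v \<in> V\<rbrakk> \<Longrightarrow>
      S x (T y v) - T y (S x v) = T (mult x y) v - T y (T x v)"

locale lsa_matched_pair =
  A: lsa_bimodule s A mA t B lA rA + B: lsa_bimodule t B mB s A lB rB
  for s :: "'f::field \<Rightarrow> 'a::ab_group_add \<Rightarrow> 'a" and A :: "'a set" and mA
    and t :: "'f \<Rightarrow> 'b::ab_group_add \<Rightarrow> 'b" and B :: "'b set" and mB
    and lA rA :: "'a \<Rightarrow> 'b \<Rightarrow> 'b" and lB rB :: "'b \<Rightarrow> 'a \<Rightarrow> 'a" +
  assumes compat_rA: "\<lbrakk>x \<in> A; a \<in> B; b \<in> B\<rbrakk> \<Longrightarrow>
      rA x (comm_bracket mB a b) =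
        rA (lB b x) a - rA (lB a x) b + mB a (rA x b) - mB b (rA x a)"
    and compat_lA: "\<lbrakk>x \<in> A; a \<in> B; b \<in> B\<rbrakk> \<Longrightarrow>
      lA x (mB a b) =
        - lA (lB a x - rB a x) b + mB (lA x a - rA x a) b + rA (rB b x) a + mB a (lA x b)"
    and compat_rB: "\<lbrakk>a \<in> B; x \<in> A; y \<in> A\<rbrakk> \<Longrightarrow>
      rB a (comm_bracket mA x y) =
        rB (lA y a) x - rB (lA x a) y + mA x (rB a y) - mA y (rB a x)"
    and compat_lB: "\<lbrakk>a \<in> B; x \<in> A; y \<in> A\<rbrakk> \<Longrightarrow>
      lB a (mA x y) =
        - lB (lA x a - rA x a) y + mA (lB a x - rB a x) y + rB (rA y a) x + mA x (lB a y)"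

subsection \<open>Parakaehler Lie algebras\<close>

definition lie_subalgebra ::
  "('f::field \<Rightarrow> 'v::ab_group_add \<Rightarrow> 'v) \<Rightarrow> 'v set \<Rightarrow> ('v \<Rightarrow> 'v \<Rightarrow> 'v) \<Rightarrow> 'v set \<Rightarrow> bool" where
  "lie_subalgebra s G bracket H \<longleftrightarrow>
     H \<subseteq> G \<and> module.subspace s H \<and> (\<forall>x\<in>H. \<forall>y\<in>H. bracket x y \<in> H)"

definition lagrangian :: "'v set \<Rightarrow> ('v \<Rightarrow> 'v \<Rightarrow> 'f::zero) \<Rightarrow> 'v set \<Rightarrow> bool" where
  "lagrangian G \<omega> H \<longleftrightarrow> H = {x \<in> G. \<forall>y\<in>H. \<omega> x y = 0}"

locale parakaehler_lie_algebra = lie_algebra scale G bracket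
  for scale :: "'f::field \<Rightarrow> 'v::ab_group_add \<Rightarrow> 'v" and G :: "'v set" and bracket +
  fixes Gp Gm :: "'v set" and \<omega> :: "'v \<Rightarrow> 'v \<Rightarrow> 'f"
  assumes form_bilinear: "bilinear_on scale G scale G (*) UNIV \<omega>"
    and form_skew: "\<lbrakk>x \<in> G; y \<in> G\<rbrakk> \<Longrightarrow> \<omega> x y = - \<omega> y x"
    and form_nondegenerate: "\<lbrakk>x \<in> G; \<And>y. y \<in> G \<Longrightarrow> \<omega> x y = 0\<rbrakk> \<Longrightarrow> x = 0"
    and form_closed: "\<lbrakk>x \<in> G; y \<in> G; z \<in> G\<rbrakk> \<Longrightarrow>
      \<omega> (bracket x y) z + \<omega> (bracket y z) x + \<omega> (bracket z x) y = 0"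
    and subalgebra_plus: "lie_subalgebra scale G bracket Gp"
    and subalgebra_minus: "lie_subalgebra scale G bracket Gm"
    and lagrangian_plus: "lagrangian G \<omega> Gp"
    and lagrangian_minus: "lagrangian G \<omega> Gm"
    and sum_carrier: "G = {x + y | x y. x \<in> Gp \<and> y \<in> Gm}"
    and inter_trivial: "Gp \<inter> Gm = {0}"

subsection \<open>The dual space\<close>

definition dual :: "('f::field \<Rightarrow> 'a::ab_group_add \<Rightarrow> 'a) \<Rightarrow> ('a \<Rightarrow> 'f) set" where
  "dual s = {f. Vector_Spaces.linear s (*) f}"

definition fun_scale :: "'f::times \<Rightarrow> ('a \<Rightarrow> 'f) \<Rightarrow> 'a \<Rightarrow> 'f" where
  "fun_scale c f = (\<lambda>x. c * f x)"

definition transpose_map :: "('v \<Rightarrow> 'v) \<Rightarrow> ('v \<Rightarrow> 'f) \<Rightarrow> 'v \<Rightarrow> 'f" where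
  "transpose_map h f = (\<lambda>v. f (h v))"

definition dual_rep :: "('x \<Rightarrow> 'v \<Rightarrow> 'v) \<Rightarrow> 'x \<Rightarrow> ('v \<Rightarrow> 'f::ab_group_add) \<Rightarrow> 'v \<Rightarrow> 'f" where
  "dual_rep \<rho> x u = (\<lambda>v. - u (\<rho> x v))"

definition ev :: "'a \<Rightarrow> ('a \<Rightarrow> 'f) \<Rightarrow> 'f" where
  "ev x = (\<lambda>f. f x)"

text \<open>
  The inverse of the canonical isomorphism \<open>ev : A \<rightarrow> A**\<close> (see \<open>unbidual_eqI\<close> and
  \<open>unbidual_works\<close> below). The maps \<open>bidual_rep\<close> and \<open>bidual_transp\<close>
  are the dual representation and the transpose of maps on \<open>A*\<close>, transported from
  \<open>A**\<close> to \<open>A\<close> along it.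
\<close>

definition unbidual :: "('f::field \<Rightarrow> 'a::ab_group_add \<Rightarrow> 'a) \<Rightarrow> (('a \<Rightarrow> 'f) \<Rightarrow> 'f) \<Rightarrow> 'a" where
  "unbidual s \<phi> = (THE x. \<forall>f\<in>dual s. ev x f = \<phi> f)"

definition bidual_rep ::
  "('f::field \<Rightarrow> 'a::ab_group_add \<Rightarrow> 'a) \<Rightarrow> ('x \<Rightarrow> ('a \<Rightarrow> 'f) \<Rightarrow> 'a \<Rightarrow> 'f) \<Rightarrow> 'x \<Rightarrow> 'a \<Rightarrow> 'a" where
  "bidual_rep s \<rho> a x = unbidual s (dual_rep \<rho> a (ev x))"

definition bidual_transp ::
  "('f::field \<Rightarrow> 'a::ab_group_add \<Rightarrow> 'a) \<Rightarrow> (('a \<Rightarrow> 'f) \<Rightarrow> 'a \<Rightarrow> 'f) \<Rightarrow> 'a \<Rightarrow> 'a" where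
  "bidual_transp s h x = unbidual s (transpose_map h (ev x))"

subsection \<open>Tensor squares\<close>

text \<open>
  For a finite-dimensional space \<open>V\<close> in duality with \<open>W\<close>, the tensor square
  \<open>V \<otimes> V\<close> is realised as the space of bilinear forms on \<open>W\<close>, made zero outside
  \<open>W\<close> so that equality of forms is equality of functions. This is used for
  \<open>V = A, W = A*\<close> and for \<open>V = A*, W = A\<close>.
  A vector of \<open>V\<close> enters \<open>tensor\<close> as a linear functional on \<open>W\<close>: the
  elementary tensors are \<open>tensor (dual s) (ev x) (ev y)\<close> and \<open>tensor UNIV f g\<close>.
  The lemmas below show that these span and have the universal property.
\<close>

definition tensor_square :: "('f::field \<Rightarrow> 'w::plus \<Rightarrow> 'w) \<Rightarrow> 'w set \<Rightarrow> ('w \<Rightarrow> 'w \<Rightarrow> 'f) set" where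
  "tensor_square s W =
     {T. bilinear_on s W s W (*) UNIV T \<and> (\<forall>u v. u \<notin> W \<or> v \<notin> W \<longrightarrow> T u v = 0)}"

definition tensor_scale :: "'f::times \<Rightarrow> ('w \<Rightarrow> 'w \<Rightarrow> 'f) \<Rightarrow> 'w \<Rightarrow> 'w \<Rightarrow> 'f" where
  "tensor_scale c T = (\<lambda>u v. c * T u v)"

definition tensor :: "'w set \<Rightarrow> ('w \<Rightarrow> 'f::field) \<Rightarrow> ('w \<Rightarrow> 'f) \<Rightarrow> 'w \<Rightarrow> 'w \<Rightarrow> 'f" where
  "tensor W p q = (\<lambda>u v. if u \<in> W \<and> v \<in> W then p u * q v else 0)"

text \<open>
  The operator \<open>h \<otimes> k\<close> on \<open>V \<otimes> V\<close>, given the transposes \<open>h'\<close>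
  and \<open>k'\<close> on \<open>W\<close> of \<open>h\<close> and \<open>k\<close>.
\<close>

definition tensor_map ::
  "'w set \<Rightarrow> ('w \<Rightarrow> 'w) \<Rightarrow> ('w \<Rightarrow> 'w) \<Rightarrow> ('w \<Rightarrow> 'w \<Rightarrow> 'f::field) \<Rightarrow> 'w \<Rightarrow> 'w \<Rightarrow> 'f" where
  "tensor_map W h' k' T = (\<lambda>u v. if u \<in> W \<and> v \<in> W then T (h' u) (k' v) else 0)"

subsection \<open>Left-symmetric bialgebras\<close>

text \<open>
  \<open>L_ad_action W tr m\<close> is the representation \<open>L \<otimes> 1 + 1 \<otimes> ad\<close> on the tensor square
  realised on \<open>W\<close>, where \<open>tr\<close> takes an operator to its transpose.
\<close>

definition L_ad_action ::
  "'w set \<Rightarrow> (('v \<Rightarrow> 'v) \<Rightarrow> 'w \<Rightarrow> 'w) \<Rightarrow> ('v::ab_group_add \<Rightarrow> 'v \<Rightarrow> 'v) \<Rightarrow>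
     'v \<Rightarrow> ('w \<Rightarrow> 'w \<Rightarrow> 'f::field) \<Rightarrow> 'w \<Rightarrow> 'w \<Rightarrow> 'f" where
  "L_ad_action W tr m x T =
     tensor_map W (tr (L_op m x)) (tr id) T + tensor_map W (tr id) (tr (ad_op m x)) T"

text \<open>
  The dual maps of the products on \<open>A*\<close> and on \<open>A\<close>:
  \<open>\<langle>\<alpha>(x), f \<otimes> g\<rangle> = \<langle>x, f \<circ> g\<rangle>\<close> and
  \<open>\<langle>\<beta>(f), x \<otimes> y\<rangle> = \<langle>f, x \<cdot> y\<rangle>\<close>.
\<close>

definition comult ::
  "('f::field \<Rightarrow> 'a::ab_group_add \<Rightarrow> 'a) \<Rightarrow> (('a \<Rightarrow> 'f) \<Rightarrow> ('a \<Rightarrow> 'f) \<Rightarrow> 'a \<Rightarrow> 'f) \<Rightarrow>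
     'a \<Rightarrow> ('a \<Rightarrow> 'f) \<Rightarrow> ('a \<Rightarrow> 'f) \<Rightarrow> 'f" where
  "comult s dmult x = (\<lambda>f g. if f \<in> dual s \<and> g \<in> dual s then (dmult f g) x else 0)"

definition dual_comult :: "('a \<Rightarrow> 'a \<Rightarrow> 'a) \<Rightarrow> ('a \<Rightarrow> 'f) \<Rightarrow> 'a \<Rightarrow> 'a \<Rightarrow> 'f" where
  "dual_comult mult f = (\<lambda>x y. f (mult x y))"

locale left_symmetric_bialgebra =
  A: left_symmetric_algebra s UNIV mult +
  D: left_symmetric_algebra fun_scale "dual s" dmult +
  \<alpha>: lie_cocycle s UNIV "comm_bracket mult"
      tensor_scale "tensor_square fun_scale (dual s)"
      "L_ad_action (dual s) transpose_map mult" "comult s dmult" +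
  \<beta>: lie_cocycle fun_scale "dual s" "comm_bracket dmult"
      tensor_scale "tensor_square s UNIV"
      "L_ad_action UNIV (bidual_transp s) dmult" "dual_comult mult"
  for s :: "'f::field \<Rightarrow> 'a::ab_group_add \<Rightarrow> 'a" and mult :: "'a \<Rightarrow> 'a \<Rightarrow> 'a"
    and dmult :: "('a \<Rightarrow> 'f) \<Rightarrow> ('a \<Rightarrow> 'f) \<Rightarrow> 'a \<Rightarrow> 'f"

subsection \<open>The double \<open>A \<oplus> A*\<close>\<close>

definition double_scale ::
  "('f::field \<Rightarrow> 'a \<Rightarrow> 'a) \<Rightarrow> 'f \<Rightarrow> 'a \<times> ('a \<Rightarrow> 'f) \<Rightarrow> 'a \<times> ('a \<Rightarrow> 'f)" where
  "double_scale s c = (\<lambda>(x, f). (s c x, fun_scale c f))"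

definition double_bracket ::
  "('f::field \<Rightarrow> 'a::ab_group_add \<Rightarrow> 'a) \<Rightarrow> ('a \<Rightarrow> 'a \<Rightarrow> 'a) \<Rightarrow>
     (('a \<Rightarrow> 'f) \<Rightarrow> ('a \<Rightarrow> 'f) \<Rightarrow> 'a \<Rightarrow> 'f) \<Rightarrow>
     'a \<times> ('a \<Rightarrow> 'f) \<Rightarrow> 'a \<times> ('a \<Rightarrow> 'f) \<Rightarrow> 'a \<times> ('a \<Rightarrow> 'f)" where
  "double_bracket s mult dmult = (\<lambda>(x, a) (y, b).
     (comm_bracket mult x y
        + bidual_rep s (L_op dmult) a y - bidual_rep s (L_op dmult) b x,
      comm_bracket dmult a b
        + dual_rep (L_op mult) x b - dual_rep (L_op mult) y a))"

definition double_form ::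
  "'a \<times> ('a \<Rightarrow> 'f::field) \<Rightarrow> 'a \<times> ('a \<Rightarrow> 'f) \<Rightarrow> 'f" where
  "double_form = (\<lambda>(x, a) (y, b). a y - b x)"

subsection \<open>Adequacy of the bidual and tensor encodings\<close>

lemma vector_space_fun_scale: "vector_space (fun_scale :: 'f::field \<Rightarrow> ('a \<Rightarrow> 'f) \<Rightarrow> 'a \<Rightarrow> 'f)"
  by unfold_locales (auto simp: fun_scale_def fun_eq_iff algebra_simps)

lemma vector_space_tensor_scale:
  "vector_space (tensor_scale :: 'f::field \<Rightarrow> ('w \<Rightarrow> 'w \<Rightarrow> 'f) \<Rightarrow> 'w \<Rightarrow> 'w \<Rightarrow> 'f)"
  by unfold_locales (auto simp: tensor_scale_def fun_eq_iff algebra_simps)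

lemma sum_fun_apply: "(\<Sum>i\<in>I. F i) x = (\<Sum>i\<in>I. F i x)"
  by (induction I rule: infinite_finite_induct) simp_all

lemma vector_space_mult: "vector_space ((*) :: 'f::field \<Rightarrow> 'f \<Rightarrow> 'f)"
  by unfold_locales (auto simp: algebra_simps)

lemma linear_on_sum:
  fixes s :: "'f::field \<Rightarrow> 'u::ab_group_add \<Rightarrow> 'u" and t :: "'f \<Rightarrow> 'v::ab_group_add \<Rightarrow> 'v"
  assumes h: "linear_on s U t V h" and U: "vector_space_on s U" and t: "vector_space t"
    and "finite I" "\<And>i. i \<in> I \<Longrightarrow> u i \<in> U"
  shows "h (\<Sum>i\<in>I. s (c i) (u i)) = (\<Sum>i\<in>I. t (c i) (h (u i)))"
proof -
  interpret U: vector_space_on s U by (rule U)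
  interpret t: vector_space t by (rule t)
  have h0: "h 0 = 0"
  proof -
    have "h (s 0 0) = t 0 (h 0)"
      using h U.subspace_0[OF U.subspace_carrier] unfolding linear_on_def by blast
    then show ?thesis by simp
  qed
  have "(\<Sum>i\<in>I. s (c i) (u i)) \<in> U \<and> h (\<Sum>i\<in>I. s (c i) (u i)) = (\<Sum>i\<in>I. t (c i) (h (u i)))"
    using assms(4,5)
  proof (induction I rule: finite_induct)
    case empty
    then show ?case using h0 U.subspace_0[OF U.subspace_carrier] by simp
  next
    case (insert j J)
    have "s (c j) (u j) \<in> U"
      using insert.prems U.subspace_scale[OF U.subspace_carrier] by simp
    then show ?case
      using insert h U.subspace_add[OF U.subspace_carrier] unfolding linear_on_def by auto
  qed
  then show ?thesis ..
qed

context finite_dimensional_vector_space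
begin

abbreviation coord :: "'b \<Rightarrow> 'b \<Rightarrow> 'a" where
  "coord i \<equiv> (\<lambda>v. representation Basis v i)"

lemma coord_dual: "coord i \<in> dual scale"
  unfolding dual_def
  using linear_representation[OF independent_Basis span_Basis] by simp

lemma coord_expansion: "(\<Sum>i\<in>Basis. scale (coord i v) i) = v"
  by (rule sum_representation_eq) (simp_all add: independent_Basis span_Basis finite_Basis)

lemma dualD:
  assumes "f \<in> dual scale"
  shows "f (x + y) = f x + f y" "f (scale c x) = c * f x" "f (\<Sum>i\<in>I. h i) = (\<Sum>i\<in>I. f (h i))"
proof -
  interpret f: Vector_Spaces.linear scale "(*)" f using assms by (simp add: dual_def)
  show "f (x + y) = f x + f y" "f (scale c x) = c * f x" "f (\<Sum>i\<in>I. h i) = (\<Sum>i\<in>I. f (h i))"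
    by (simp_all add: f.add f.scale f.sum)
qed

lemma dualI:
  assumes "\<And>x y. f (x + y) = f x + f y" "\<And>c x. f (scale c x) = c * f x"
  shows "f \<in> dual scale"
  unfolding dual_def mem_Collect_eq
  by (intro Vector_Spaces.linear.intro module_hom.intro module_hom_axioms.intro
      vector_space_axioms vector_space_mult)
     (use assms vector_space_axioms vector_space_mult in \<open>auto simp: module_iff_vector_space\<close>)

lemma dual_subspace: "vector_space_on fun_scale (dual scale)"
proof -
  interpret F: vector_space "fun_scale :: 'a \<Rightarrow> ('b \<Rightarrow> 'a) \<Rightarrow> 'b \<Rightarrow> 'a"
    by (rule vector_space_fun_scale)
  have "0 \<in> dual scale"
    by (rule dualI) simp_all
  moreover have "f + g \<in> dual scale" if "f \<in> dual scale" "g \<in> dual scale" for f g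
    by (rule dualI) (simp_all add: dualD[OF that(1)] dualD[OF that(2)] algebra_simps)
  moreover have "fun_scale c f \<in> dual scale" if "f \<in> dual scale" for c f
    by (rule dualI) (simp_all add: fun_scale_def dualD[OF that] algebra_simps)
  ultimately show ?thesis
    by unfold_locales (simp add: F.subspace_def)
qed

lemma dual_expansion:
  assumes "f \<in> dual scale"
  shows "(\<Sum>i\<in>Basis. fun_scale (f i) (coord i)) = f"
proof
  fix v
  have "f v = f (\<Sum>i\<in>Basis. scale (coord i v) i)" by (simp only: coord_expansion)
  also have "\<dots> = (\<Sum>i\<in>Basis. coord i v * f i)" by (simp add: dualD[OF assms])
  also have "\<dots> = (\<Sum>i\<in>Basis. fun_scale (f i) (coord i)) v"
    by (simp add: sum_fun_apply fun_scale_def mult.commute)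
  finally show "(\<Sum>i\<in>Basis. fun_scale (f i) (coord i)) v = f v" ..
qed

lemma dual_separates:
  assumes "\<And>f. f \<in> dual scale \<Longrightarrow> f x = f y"
  shows "x = y"
proof -
  have "(\<Sum>i\<in>Basis. scale (coord i x) i) = (\<Sum>i\<in>Basis. scale (coord i y) i)"
    by (intro sum.cong refl arg_cong2[where f = scale] assms coord_dual)
  then show ?thesis by (simp only: coord_expansion)
qed

lemma unbidual_eqI:
  assumes "\<And>f. f \<in> dual scale \<Longrightarrow> f x = \<phi> f"
  shows "unbidual scale \<phi> = x"
  unfolding unbidual_def ev_def
  by (rule the_equality) (auto simp: assms intro: dual_separates)

lemma unbidual_works:
  assumes \<phi>: "linear_on fun_scale (dual scale) (*) UNIV \<phi>" and f: "f \<in> dual scale"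
  shows "f (unbidual scale \<phi>) = \<phi> f"
proof -
  define x where "x = (\<Sum>i\<in>Basis. scale (\<phi> (coord i)) i)"
  have "g x = \<phi> g" if g: "g \<in> dual scale" for g
  proof -
    have "\<phi> g = (\<Sum>i\<in>Basis. g i * \<phi> (coord i))"
      using linear_on_sum[OF \<phi> dual_subspace vector_space_mult finite_Basis, of coord g]
      by (simp add: dual_expansion[OF g] coord_dual)
    then show ?thesis by (simp add: x_def dualD[OF g] mult.commute)
  qed
  then show ?thesis using unbidual_eqI[of x \<phi>] f by simp
qed

lemma tensor_in_square:
  "tensor (dual scale) (ev x) (ev y) \<in> tensor_square fun_scale (dual scale)"
proof -
  interpret D: vector_space_on "fun_scale :: 'a \<Rightarrow> ('b \<Rightarrow> 'a) \<Rightarrow> 'b \<Rightarrow> 'a" "dual scale"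
    by (rule dual_subspace)
  show ?thesis
    using D.subspace_add[OF D.subspace_carrier] D.subspace_scale[OF D.subspace_carrier]
    by (auto simp: tensor_square_def bilinear_on_def linear_on_def tensor_def ev_def
        fun_scale_def algebra_simps)
qed

lemma tensor_in_square_dual:
  assumes "f \<in> dual scale" "g \<in> dual scale"
  shows "tensor UNIV f g \<in> tensor_square scale UNIV"
  by (simp add: tensor_square_def bilinear_on_def linear_on_def tensor_def
      dualD[OF assms(1)] dualD[OF assms(2)] algebra_simps)

lemma tensor_map_tensor:
  assumes "Vector_Spaces.linear scale scale h" "Vector_Spaces.linear scale scale k"
  shows "tensor_map (dual scale) (transpose_map h) (transpose_map k) (tensor (dual scale) (ev x) (ev y))
         = tensor (dual scale) (ev (h x)) (ev (k y))"
proof -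
  have "transpose_map h f \<in> dual scale" "transpose_map k f \<in> dual scale" if f: "f \<in> dual scale" for f
    using f Vector_Spaces.linear_compose[OF assms(1), of "(*)" f]
      Vector_Spaces.linear_compose[OF assms(2), of "(*)" f]
    by (simp_all add: dual_def transpose_map_def o_def)
  then show ?thesis
    by (auto simp: tensor_map_def tensor_def ev_def transpose_map_def fun_eq_iff)
qed

lemma bidual_transp_works:
  assumes h: "linear_on fun_scale (dual scale) fun_scale (dual scale) h" and f: "f \<in> dual scale"
  shows "f (bidual_transp scale h x) = h f x"
proof -
  have "linear_on fun_scale (dual scale) (*) UNIV (transpose_map h (ev x))"
    using h by (auto simp: linear_on_def transpose_map_def ev_def fun_scale_def)
  from unbidual_works[OF this f] show ?thesis
    by (simp add: bidual_transp_def transpose_map_def ev_def)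
qed

lemma tensor_map_tensor_dual:
  assumes "linear_on fun_scale (dual scale) fun_scale (dual scale) h"
    and "linear_on fun_scale (dual scale) fun_scale (dual scale) k"
    and "f \<in> dual scale" "g \<in> dual scale"
  shows "tensor_map UNIV (bidual_transp scale h) (bidual_transp scale k) (tensor UNIV f g)
         = tensor UNIV (h f) (k g)"
  using assms by (simp add: tensor_map_def tensor_def bidual_transp_works)

end

text \<open>
  Both tensor squares at once: a space \<open>W\<close> with finite dual bases \<open>w i\<close> of \<open>W\<close> and
  \<open>e i\<close> of the functionals on \<open>W\<close>.
\<close>

lemma form_expansion:
  fixes s :: "'f::field \<Rightarrow> 'w::ab_group_add \<Rightarrow> 'w"
  assumes W: "vector_space_on s W" and I: "finite I"
    and w: "\<And>i. i \<in> I \<Longrightarrow> w i \<in> W"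
    and e: "\<And>u. u \<in> W \<Longrightarrow> (\<Sum>i\<in>I. s (e i u) (w i)) = u"
    and T: "T \<in> tensor_square s W"
  shows "T = (\<Sum>i\<in>I. \<Sum>j\<in>I. tensor_scale (T (w i) (w j)) (tensor W (e i) (e j)))"
proof (intro ext)
  fix u v
  have sum: "h (\<Sum>i\<in>I. s (c i) (w i)) = (\<Sum>i\<in>I. c i * h (w i))"
    if "linear_on s W (*) UNIV h" for h :: "'w \<Rightarrow> 'f" and c
    using linear_on_sum[OF that W vector_space_mult I] w by simp
  show "T u v = (\<Sum>i\<in>I. \<Sum>j\<in>I. tensor_scale (T (w i) (w j)) (tensor W (e i) (e j))) u v"
  proof (cases "u \<in> W \<and> v \<in> W")
    case True
    have "T u v = (\<Sum>i\<in>I. e i u * T (w i) v)"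
      using sum[of "\<lambda>u. T u v" "\<lambda>i. e i u"] T True e
      by (simp add: tensor_square_def bilinear_on_def)
    also have "\<dots> = (\<Sum>i\<in>I. e i u * (\<Sum>j\<in>I. e j v * T (w i) (w j)))"
      using sum[of "T (w i)" "\<lambda>j. e j v" for i] T True e w
      by (intro sum.cong refl) (simp add: tensor_square_def bilinear_on_def)
    finally show ?thesis
      using True by (simp add: sum_fun_apply tensor_scale_def tensor_def sum_distrib_left mult_ac)
  next
    case False
    then show ?thesis
      using T by (auto simp: sum_fun_apply tensor_scale_def tensor_def tensor_square_def)
  qed
qed

context finite_dimensional_vector_space
begin

lemma tensor_expansion:
  assumes "T \<in> tensor_square fun_scale (dual scale)"
  shows "T = (\<Sum>i\<in>Basis. \<Sum>j\<in>Basis. tensor_scale (T (coord i) (coord j))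
               (tensor (dual scale) (ev i) (ev j)))"
  by (rule form_expansion[OF dual_subspace finite_Basis coord_dual _ assms])
     (simp add: ev_def dual_expansion)

lemma tensor_expansion_dual:
  assumes "T \<in> tensor_square scale UNIV"
  shows "T = (\<Sum>i\<in>Basis. \<Sum>j\<in>Basis. tensor_scale (T i j) (tensor UNIV (coord i) (coord j)))"
proof -
  have "vector_space_on scale UNIV" by unfold_locales simp
  from form_expansion[OF this finite_Basis, of "\<lambda>i. i" coord T]
  show ?thesis using assms coord_expansion by simp
qed

lemma tensor_universal:
  assumes t: "vector_space t" and b: "bilinear_on scale UNIV scale UNIV t UNIV b"
  shows "\<exists>h. linear_on tensor_scale (tensor_square fun_scale (dual scale)) t UNIV h \<and>
             (\<forall>x y. h (tensor (dual scale) (ev x) (ev y)) = b x y)"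
proof -
  interpret t: vector_space t by (rule t)
  have U: "vector_space_on scale UNIV" by unfold_locales simp
  define h where "h = (\<lambda>T. \<Sum>i\<in>Basis. \<Sum>j\<in>Basis. t (T (coord i) (coord j)) (b i j))"
  have "h (tensor (dual scale) (ev x) (ev y)) = b x y" for x y
  proof -
    have "b x y = b (\<Sum>i\<in>Basis. scale (coord i x) i) (\<Sum>j\<in>Basis. scale (coord j y) j)"
      by (simp only: coord_expansion)
    also have "\<dots> = (\<Sum>i\<in>Basis. t (coord i x) (b i (\<Sum>j\<in>Basis. scale (coord j y) j)))"
      using b by (intro linear_on_sum[OF _ U t finite_Basis]) (auto simp: bilinear_on_def)
    also have "\<dots> = (\<Sum>i\<in>Basis. t (coord i x) (\<Sum>j\<in>Basis. t (coord j y) (b i j)))"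
      using b by (intro sum.cong refl arg_cong[where f = "t _"] linear_on_sum[OF _ U t finite_Basis])
        (auto simp: bilinear_on_def)
    finally show ?thesis
      by (simp add: h_def tensor_def coord_dual ev_def t.scale_sum_right)
  qed
  moreover have "linear_on tensor_scale (tensor_square fun_scale (dual scale)) t UNIV h"
    by (simp add: linear_on_def h_def tensor_scale_def t.scale_left_distrib sum.distrib
        t.scale_sum_right)
  ultimately show ?thesis by blast
qed

lemma tensor_universal_dual:
  assumes t: "vector_space t"
    and b: "bilinear_on fun_scale (dual scale) fun_scale (dual scale) t UNIV b"
  shows "\<exists>h. linear_on tensor_scale (tensor_square scale UNIV) t UNIV h \<and>
             (\<forall>f\<in>dual scale. \<forall>g\<in>dual scale. h (tensor UNIV f g) = b f g)"
proof -
  interpret t: vector_space t by (rule t)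
  define h where "h = (\<lambda>T. \<Sum>i\<in>Basis. \<Sum>j\<in>Basis. t (T i j) (b (coord i) (coord j)))"
  have "h (tensor UNIV f g) = b f g" if fg: "f \<in> dual scale" "g \<in> dual scale" for f g
  proof -
    have "b f g = b (\<Sum>i\<in>Basis. fun_scale (f i) (coord i)) g"
      by (simp only: dual_expansion[OF fg(1)])
    also have "\<dots> = (\<Sum>i\<in>Basis. t (f i) (b (coord i) g))"
      using b fg by (intro linear_on_sum[OF _ dual_subspace t finite_Basis])
        (auto simp: bilinear_on_def coord_dual)
    also have "\<dots> = (\<Sum>i\<in>Basis. t (f i) (b (coord i) (\<Sum>j\<in>Basis. fun_scale (g j) (coord j))))"
      by (simp only: dual_expansion[OF fg(2)])
    also have "\<dots> = (\<Sum>i\<in>Basis. t (f i) (\<Sum>j\<in>Basis. t (g j) (b (coord i) (coord j))))"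
      using b by (intro sum.cong refl arg_cong[where f = "t _"]
          linear_on_sum[OF _ dual_subspace t finite_Basis])
        (auto simp: bilinear_on_def coord_dual)
    finally show ?thesis
      by (simp add: h_def tensor_def t.scale_sum_right)
  qed
  moreover have "linear_on tensor_scale (tensor_square scale UNIV) t UNIV h"
    by (simp add: linear_on_def h_def tensor_scale_def t.scale_left_distrib sum.distrib
        t.scale_sum_right)
  ultimately show ?thesis by blast
qed

end

end

theory Submission
  imports Defs
begin

text \<open>
  Put \<open>A\<close> and \<open>B\<close> in duality by a pairing \<open>p\<close>, write \<open>E = L\<^sup>*\<close> for the dual of the left
  multiplications of \<open>A\<close>, acting on \<open>B\<close>, and \<open>D = L\<^sup>*\<close> for that of \<open>B\<close>, acting on \<open>A\<close>. Let
  \<open>P x y a b = p (x y) (a b) + p y ((E x a) b) + p (x (D a y)) b + p ((D a x) y) b\<close>.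
  Paired with an arbitrary vector, each identity in the four conditions turns into the symmetry of
  \<open>P\<close> in \<open>x, y\<close> or in \<open>a, b\<close>. The symmetry in \<open>x, y\<close> is the compatibility condition for \<open>\<mu>\<close>, the
  \<open>A\<close>-component of the Jacobi identity of the double, each of the conditions for \<open>r\<^sub>B\<close> and \<open>l\<^sub>A\<close>, and
  the cocycle identity for \<open>\<alpha>\<close>. The symmetry in \<open>a, b\<close> is the same statement with the roles of \<open>A\<close>
  and \<open>B\<close> exchanged, and gives the other halves. All remaining axioms hold automatically.
\<close>

subsection \<open>Linear maps on carriers\<close>

context vector_space_on
begin

lemma carrier_closed [simp]:
  "0 \<in> V" "x \<in> V \<Longrightarrow> y \<in> V \<Longrightarrow> x + y \<in> V" "x \<in> V \<Longrightarrow> y \<in> V \<Longrightarrow> x - y \<in> V"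
  "x \<in> V \<Longrightarrow> - x \<in> V" "x \<in> V \<Longrightarrow> scale c x \<in> V"
  using subspace_carrier
  by (simp_all add: subspace_0 subspace_add subspace_diff subspace_neg subspace_scale)

lemma linear_on_group_simps:
  fixes h :: "'v \<Rightarrow> 'c::ab_group_add"
  assumes "linear_on scale V t W h"
  shows "h 0 = 0" "\<lbrakk>x \<in> V; y \<in> V\<rbrakk> \<Longrightarrow> h (x + y) = h x + h y"
    "\<lbrakk>x \<in> V; y \<in> V\<rbrakk> \<Longrightarrow> h (x - y) = h x - h y" "x \<in> V \<Longrightarrow> h (- x) = - h x"
    "x \<in> V \<Longrightarrow> h (scale c x) = t c (h x)"
proof -
  have add: "h (x + y) = h x + h y" if "x \<in> V" "y \<in> V" for x y
    using assms that by (simp add: linear_on_def)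
  then show "\<lbrakk>x \<in> V; y \<in> V\<rbrakk> \<Longrightarrow> h (x + y) = h x + h y" .
  show zero: "h 0 = 0" using add[of 0 0] by simp
  show neg: "h (- x) = - h x" if "x \<in> V" for x
    using add[of x "- x"] that zero by (simp add: eq_neg_iff_add_eq_0 add.commute)
  show "\<lbrakk>x \<in> V; y \<in> V\<rbrakk> \<Longrightarrow> h (x - y) = h x - h y"
    using add[of x "- y"] neg by simp
  show "x \<in> V \<Longrightarrow> h (scale c x) = t c (h x)"
    using assms by (simp add: linear_on_def)
qed

end

text \<open>Closure is listed first so that \<open>(2-)\<close> selects the algebraic rules alone,
  for scalar-valued maps and for maps whose closure rule is already available.\<close>

lemma bilinear_on_simps:
  fixes b :: "'u::ab_group_add \<Rightarrow> 'v::ab_group_add \<Rightarrow> 'w::ab_group_add"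
  assumes b: "bilinear_on s U t V r W b" and U: "vector_space_on s U" and V: "vector_space_on t V"
  shows "\<lbrakk>x \<in> U; u \<in> V\<rbrakk> \<Longrightarrow> b x u \<in> W"
    "u \<in> V \<Longrightarrow> b 0 u = 0" "x \<in> U \<Longrightarrow> b x 0 = 0"
    "\<lbrakk>x \<in> U; y \<in> U; u \<in> V\<rbrakk> \<Longrightarrow> b (x + y) u = b x u + b y u"
    "\<lbrakk>x \<in> U; u \<in> V; v \<in> V\<rbrakk> \<Longrightarrow> b x (u + v) = b x u + b x v"
    "\<lbrakk>x \<in> U; y \<in> U; u \<in> V\<rbrakk> \<Longrightarrow> b (x - y) u = b x u - b y u"
    "\<lbrakk>x \<in> U; u \<in> V; v \<in> V\<rbrakk> \<Longrightarrow> b x (u - v) = b x u - b x v"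
    "\<lbrakk>x \<in> U; u \<in> V\<rbrakk> \<Longrightarrow> b (- x) u = - b x u"
    "\<lbrakk>x \<in> U; u \<in> V\<rbrakk> \<Longrightarrow> b x (- u) = - b x u"
    "\<lbrakk>x \<in> U; u \<in> V\<rbrakk> \<Longrightarrow> b (s c x) u = r c (b x u)"
    "\<lbrakk>x \<in> U; u \<in> V\<rbrakk> \<Longrightarrow> b x (t c u) = r c (b x u)"
proof -
  have l: "linear_on s U r W (\<lambda>x. b x u)" if "u \<in> V" for u
    using b that by (simp add: bilinear_on_def)
  have r: "linear_on t V r W (b x)" if "x \<in> U" for x
    using b that by (simp add: bilinear_on_def)
  note L = vector_space_on.linear_on_group_simps[OF U l]
  note R = vector_space_on.linear_on_group_simps[OF V r]
  show "\<lbrakk>x \<in> U; u \<in> V\<rbrakk> \<Longrightarrow> b x u \<in> W" using r by (simp add: linear_on_def)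
  show "u \<in> V \<Longrightarrow> b 0 u = 0" "x \<in> U \<Longrightarrow> b x 0 = 0"
    "\<lbrakk>x \<in> U; y \<in> U; u \<in> V\<rbrakk> \<Longrightarrow> b (x + y) u = b x u + b y u"
    "\<lbrakk>x \<in> U; u \<in> V; v \<in> V\<rbrakk> \<Longrightarrow> b x (u + v) = b x u + b x v"
    "\<lbrakk>x \<in> U; y \<in> U; u \<in> V\<rbrakk> \<Longrightarrow> b (x - y) u = b x u - b y u"
    "\<lbrakk>x \<in> U; u \<in> V; v \<in> V\<rbrakk> \<Longrightarrow> b x (u - v) = b x u - b x v"
    "\<lbrakk>x \<in> U; u \<in> V\<rbrakk> \<Longrightarrow> b (- x) u = - b x u"
    "\<lbrakk>x \<in> U; u \<in> V\<rbrakk> \<Longrightarrow> b x (- u) = - b x u"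
    "\<lbrakk>x \<in> U; u \<in> V\<rbrakk> \<Longrightarrow> b (s c x) u = r c (b x u)"
    "\<lbrakk>x \<in> U; u \<in> V\<rbrakk> \<Longrightarrow> b x (t c u) = r c (b x u)"
    by (simp_all add: L R)
qed

lemma bilinear_onI:
  assumes "\<And>x u. \<lbrakk>x \<in> U; u \<in> V\<rbrakk> \<Longrightarrow> b x u \<in> W"
    "\<And>x y u. \<lbrakk>x \<in> U; y \<in> U; u \<in> V\<rbrakk> \<Longrightarrow> b (x + y) u = b x u + b y u"
    "\<And>x u v. \<lbrakk>x \<in> U; u \<in> V; v \<in> V\<rbrakk> \<Longrightarrow> b x (u + v) = b x u + b x v"
    "\<And>c x u. \<lbrakk>x \<in> U; u \<in> V\<rbrakk> \<Longrightarrow> b (s c x) u = r c (b x u)"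
    "\<And>c x u. \<lbrakk>x \<in> U; u \<in> V\<rbrakk> \<Longrightarrow> b x (t c u) = r c (b x u)"
  shows "bilinear_on s U t V r W b"
  using assms by (simp add: bilinear_on_def linear_on_def)

subsection \<open>Sub-adjacent Lie algebras\<close>

context left_symmetric_algebra
begin

lemma space: "vector_space_on scale A"
  by unfold_locales

lemmas mult_simps [simp] = bilinear_on_simps[OF mult_bilinear space space]

text \<open>Left symmetry trades (xy)z - (yx)z for x(yz) - y(xz). The cyclic sum in the Jacobi
  identity then contains right-nested products only, and these cancel in pairs.\<close>

lemma sub_adjacent_lie_algebra: "lie_algebra scale A (comm_bracket mult)"
proof unfold_locales
  show "bilinear_on scale A scale A scale A (comm_bracket mult)"
    by (rule bilinear_onI) (simp_all add: comm_bracket_def algebra_simps)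
  have swap_left: "mult (mult x y) z = mult x (mult y z) + mult (mult y x) z - mult y (mult x z)"
    if "x \<in> A" "y \<in> A" "z \<in> A" for x y z
    using left_symmetric[OF that] by (simp add: algebra_simps)
  fix x y z assume [simp]: "x \<in> A" "y \<in> A" "z \<in> A"
  show "comm_bracket mult (comm_bracket mult x y) z + comm_bracket mult (comm_bracket mult y z) x
      + comm_bracket mult (comm_bracket mult z x) y = 0"
    by (simp add: comm_bracket_def swap_left[of x y z] swap_left[of y z x] swap_left[of z x y])
qed (simp add: comm_bracket_def)

end

subsection \<open>Left-symmetric algebras in duality\<close>

text \<open>The operators are parameters pinned down by their pairings, not defined terms, so that
  exchanging \<open>A\<close> and \<open>B\<close> gives another instance. Here \<open>E\<close>,
  \<open>lA\<close>, \<open>rA\<close> stand for the dual maps L*, ad*, -R* of \<open>A\<close>, and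
  \<open>D\<close>, \<open>lB\<close>, \<open>rB\<close> for those of \<open>B\<close>.\<close>

locale lsa_dual_pair =
  A: left_symmetric_algebra s A mA + B: left_symmetric_algebra t B mB
  for s :: "'f::field \<Rightarrow> 'a::ab_group_add \<Rightarrow> 'a" and A :: "'a set" and mA
    and t :: "'f \<Rightarrow> 'b::ab_group_add \<Rightarrow> 'b" and B :: "'b set" and mB +
  fixes p :: "'a \<Rightarrow> 'b \<Rightarrow> 'f"
    and E lA rA :: "'a \<Rightarrow> 'b \<Rightarrow> 'b" and D lB rB :: "'b \<Rightarrow> 'a \<Rightarrow> 'a"
  assumes pairing_bilinear: "bilinear_on s A t B (*) UNIV p"
    and separating_A: "\<lbrakk>x \<in> A; y \<in> A; \<And>b. b \<in> B \<Longrightarrow> p x b = p y b\<rbrakk> \<Longrightarrow> x = y"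
    and separating_B: "\<lbrakk>a \<in> B; b \<in> B; \<And>x. x \<in> A \<Longrightarrow> p x a = p x b\<rbrakk> \<Longrightarrow> a = b"
    and E_closed: "\<lbrakk>x \<in> A; a \<in> B\<rbrakk> \<Longrightarrow> E x a \<in> B"
    and pairing_E: "\<lbrakk>x \<in> A; y \<in> A; a \<in> B\<rbrakk> \<Longrightarrow> p y (E x a) = - p (mA x y) a"
    and rA_closed: "\<lbrakk>x \<in> A; a \<in> B\<rbrakk> \<Longrightarrow> rA x a \<in> B"
    and pairing_rA: "\<lbrakk>x \<in> A; y \<in> A; a \<in> B\<rbrakk> \<Longrightarrow> p y (rA x a) = p (mA y x) a"
    and lA_eq: "\<lbrakk>x \<in> A; a \<in> B\<rbrakk> \<Longrightarrow> lA x a = E x a + rA x a"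
    and D_closed: "\<lbrakk>x \<in> A; a \<in> B\<rbrakk> \<Longrightarrow> D a x \<in> A"
    and pairing_D: "\<lbrakk>x \<in> A; a \<in> B; b \<in> B\<rbrakk> \<Longrightarrow> p (D a x) b = - p x (mB a b)"
    and rB_closed: "\<lbrakk>x \<in> A; a \<in> B\<rbrakk> \<Longrightarrow> rB a x \<in> A"
    and pairing_rB: "\<lbrakk>x \<in> A; a \<in> B; b \<in> B\<rbrakk> \<Longrightarrow> p (rB a x) b = p x (mB b a)"
    and lB_eq: "\<lbrakk>x \<in> A; a \<in> B\<rbrakk> \<Longrightarrow> lB a x = D a x + rB a x"
begin

lemmas operator_closed [simp] = E_closed rA_closed D_closed rB_closed
lemmas pairing_operator [simp] = pairing_E pairing_rA pairing_D pairing_rB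
lemmas pairing_simps [simp] = bilinear_on_simps(2-)[OF pairing_bilinear A.space B.space]

text \<open>Every later result about one side yields its mirror image through this fact, so only one
  half of each condition is ever computed.\<close>

lemma swap: "lsa_dual_pair t B mB s A mA (\<lambda>b x. p x b) D lB rB E lA rA"
  by (unfold_locales)
     (use pairing_bilinear in \<open>auto simp: bilinear_on_def lA_eq lB_eq intro: separating_A separating_B\<close>)

section \<open>Dual actions as Lie representations and bimodules\<close>

lemma E_bilinear: "bilinear_on s A t B t B E"
  by (rule bilinear_onI) (auto intro!: separating_B)

lemma rA_bilinear: "bilinear_on s A t B t B rA"
  by (rule bilinear_onI) (auto intro!: separating_B)

lemma lA_bilinear: "bilinear_on s A t B t B lA"
  by (rule bilinear_onI) (auto intro!: separating_B simp: lA_eq algebra_simps)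

lemmas D_bilinear = lsa_dual_pair.E_bilinear[OF swap]

lemmas E_simps [simp] = bilinear_on_simps(2-)[OF E_bilinear A.space B.space]
lemmas D_simps [simp] = bilinear_on_simps(2-)[OF D_bilinear B.space A.space]

text \<open>Eliminates the left-nested product (xy)z under the pairing. The right-hand side contains
  (yx)z, so the rule would loop unless its arguments are fixed where it is used.\<close>

lemma left_symmetric_pairing:
  assumes "x \<in> A" "y \<in> A" "z \<in> A" "a \<in> B"
  shows "p (mA (mA x y) z) a = p (mA x (mA y z)) a + p (mA (mA y x) z) a - p (mA y (mA x z)) a"
  using arg_cong[OF A.left_symmetric[OF assms(1-3)], of "\<lambda>v. p v a"] assms
  by (simp add: algebra_simps)

text \<open>Left symmetry says that left multiplication represents the sub-adjacent Lie algebra, and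
  \<open>E\<close> is the dual of that representation.\<close>

lemma E_bracket:
  assumes "x \<in> A" "y \<in> A" "a \<in> B"
  shows "E (comm_bracket mA x y) a = E x (E y a) - E y (E x a)"
  using assms
  by (intro separating_B) (simp_all add: comm_bracket_def left_symmetric_pairing[of x y])

lemma E_representation: "lie_representation s A (comm_bracket mA) t B E"
  by (intro lie_representation.intro lie_representation_axioms.intro
      A.sub_adjacent_lie_algebra B.space E_bilinear E_bracket)

text \<open>\<open>lA\<close> is dual to the adjoint representation of the sub-adjacent Lie algebra,
  so this is the Jacobi identity read through the pairing.\<close>

lemma lA_bracket:
  assumes "x \<in> A" "y \<in> A" "a \<in> B"
  shows "lA (comm_bracket mA x y) a = lA x (lA y a) - lA y (lA x a)"
proof (intro separating_B)
  fix z assume [simp]: "z \<in> A"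
  note [simp] = assms
  show "p z (lA (comm_bracket mA x y) a) = p z (lA x (lA y a) - lA y (lA x a))"
    by (simp add: lA_eq comm_bracket_def left_symmetric_pairing[of x y z a]
        left_symmetric_pairing[of x z y a] left_symmetric_pairing[of y z x a])
qed (use assms in \<open>simp_all add: lA_eq comm_bracket_def\<close>)

text \<open>This is the dual of the regular bimodule (L, R). The first axiom restates that
  \<open>lA\<close> represents the commutator bracket; the second, paired with z, is left symmetry
  for x, z, y.\<close>

lemma bimodule: "lsa_bimodule s A mA t B lA rA"
proof (intro lsa_bimodule.intro lsa_bimodule_axioms.intro A.left_symmetric_algebra_axioms
    B.space lA_bilinear rA_bilinear)
  fix x y a assume [simp]: "x \<in> A" "y \<in> A" "a \<in> B"
  have "lA (mA x y) a - lA (mA y x) a = lA (comm_bracket mA x y) a"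
    by (simp add: comm_bracket_def bilinear_on_simps[OF lA_bilinear A.space B.space])
  then show "lA x (lA y a) - lA (mA x y) a = lA y (lA x a) - lA (mA y x) a"
    by (simp add: lA_bracket algebra_simps)
  show "lA x (rA y a) - rA y (lA x a) = rA (mA x y) a - rA y (rA x a)"
  proof (intro separating_B)
    fix z assume [simp]: "z \<in> A"
    show "p z (lA x (rA y a) - rA y (lA x a)) = p z (rA (mA x y) a - rA y (rA x a))"
      using left_symmetric_pairing[of x z y a] by (simp add: lA_eq algebra_simps)
  qed (simp_all add: lA_eq)
qed

section \<open>The mixed form and its normalisation\<close>

definition mixed :: "'a \<Rightarrow> 'a \<Rightarrow> 'b \<Rightarrow> 'b \<Rightarrow> 'f" where
  "mixed x y a b = p (mA x y) (mB a b) + p y (mB (E x a) b) + p (mA x (D a y)) b + p (mA (D a x) y) b"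

definition mixed_symmetric :: bool where
  "mixed_symmetric \<longleftrightarrow> (\<forall>x\<in>A. \<forall>y\<in>A. \<forall>a\<in>B. \<forall>b\<in>B. mixed x y a b = mixed y x a b)"

text \<open>Both sides equal \<open>- p (D a y) (E x b)\<close>, evaluated once through
  \<open>D\<close> and once through \<open>E\<close>.\<close>

lemma pairing_mult_E:
  assumes "x \<in> A" "y \<in> A" "a \<in> B" "b \<in> B"
  shows "p y (mB a (E x b)) = p (mA x (D a y)) b"
  using pairing_E[of x "D a y" b] pairing_D[of y a "E x b"] assms by (simp del: pairing_operator)

lemma pairing_mult_rA:
  assumes "x \<in> A" "y \<in> A" "a \<in> B" "b \<in> B"
  shows "p y (mB a (rA x b)) = - p (mA (D a y) x) b"
  using assms by (simp del: pairing_operator add: pairing_rA[symmetric] pairing_D)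

lemma pairing_mult_rB:
  assumes "x \<in> A" "y \<in> A" "a \<in> B" "b \<in> B"
  shows "p (mA y (rB b x)) a = - p x (mB (E y a) b)"
  using pairing_E[of y "rB b x" a] pairing_rB[of x b "E y a"] assms by (simp del: pairing_operator)

text \<open>
  These three identities normalise all mixed terms to those occurring in \<open>mixed\<close>; they are not
  simp rules because the operator rules for \<open>p\<close> rewrite in the opposite direction.
\<close>

lemmas pairing_mixed = pairing_mult_E pairing_mult_rA pairing_mult_rB

lemma eq_iff_pairing:
  "\<lbrakk>x \<in> A; y \<in> A\<rbrakk> \<Longrightarrow> x = y \<longleftrightarrow> (\<forall>b\<in>B. p x b = p y b)"
  "\<lbrakk>a \<in> B; b \<in> B\<rbrakk> \<Longrightarrow> a = b \<longleftrightarrow> (\<forall>x\<in>A. p x a = p x b)"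
  using separating_A separating_B by blast+

section \<open>Matched pairs as symmetry of the mixed form\<close>

lemma compat_\<mu>_iff:
  "(\<forall>a\<in>B. \<forall>x\<in>A. \<forall>y\<in>A. D a (comm_bracket mA x y) - comm_bracket mA (D a x) y
      - comm_bracket mA x (D a y) + D (E x a) y - D (E y a) x = 0) \<longleftrightarrow> mixed_symmetric"
proof -
  \<comment> \<open>Pairing the left-hand side with \<open>b\<close> gives
    \<open>mixed y x a b - mixed x y a b\<close>.\<close>
  have "D a (comm_bracket mA x y) - comm_bracket mA (D a x) y
      - comm_bracket mA x (D a y) + D (E x a) y - D (E y a) x = 0
     \<longleftrightarrow> (\<forall>b\<in>B. mixed x y a b = mixed y x a b)" if "x \<in> A" "y \<in> A" "a \<in> B" for x y a
    using that
    by (subst eq_iff_pairing) (auto simp: comm_bracket_def mixed_def algebra_simps)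
  then show ?thesis unfolding mixed_symmetric_def by blast
qed

lemma compat_rB_iff:
  "(\<forall>a\<in>B. \<forall>x\<in>A. \<forall>y\<in>A. rB a (comm_bracket mA x y) =
        rB (lA y a) x - rB (lA x a) y + mA x (rB a y) - mA y (rB a x)) \<longleftrightarrow> mixed_symmetric"
proof -
  \<comment> \<open>Since \<open>rB a\<close> is dual to right multiplication by \<open>a\<close>,
    the test vector \<open>b\<close> stands to the left of \<open>a\<close>; hence the order
    \<open>b a\<close> in \<open>mixed\<close>.\<close>
  have "rB a (comm_bracket mA x y) =
        rB (lA y a) x - rB (lA x a) y + mA x (rB a y) - mA y (rB a x)
     \<longleftrightarrow> (\<forall>b\<in>B. mixed x y b a = mixed y x b a)" if "x \<in> A" "y \<in> A" "a \<in> B" for x y a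
    using that
    by (subst eq_iff_pairing)
       (auto simp: comm_bracket_def mixed_def lA_eq pairing_mixed algebra_simps)
  then show ?thesis unfolding mixed_symmetric_def by blast
qed

lemma compat_lA_iff:
  "(\<forall>x\<in>A. \<forall>a\<in>B. \<forall>b\<in>B. lA x (mB a b) =
        - lA (lB a x - rB a x) b + mB (lA x a - rA x a) b + rA (rB b x) a + mB a (lA x b))
    \<longleftrightarrow> mixed_symmetric"
proof -
  \<comment> \<open>This identity lives in \<open>B\<close>, so the test vector is the second
    element \<open>y\<close> of \<open>A\<close>. The left-hand side paired with \<open>y\<close> is
    the pairing of yx - xy with the product of \<open>a\<close> and \<open>b\<close>, which brings
    in the symmetry in \<open>x\<close> and \<open>y\<close>.\<close>
  have "lA x (mB a b) =
        - lA (lB a x - rB a x) b + mB (lA x a - rA x a) b + rA (rB b x) a + mB a (lA x b)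
     \<longleftrightarrow> (\<forall>y\<in>A. mixed x y a b = mixed y x a b)" if "x \<in> A" "a \<in> B" "b \<in> B" for x a b
    using that
    by (subst eq_iff_pairing)
       (auto simp: mixed_def lA_eq lB_eq pairing_mixed algebra_simps)
  then show ?thesis unfolding mixed_symmetric_def by blast
qed

text \<open>The hub of the equivalence: each of the four conditions is shown equivalent to
  it.\<close>

definition compatible :: bool where
  "compatible \<longleftrightarrow> mixed_symmetric \<and>
     lsa_dual_pair.mixed_symmetric B mB A mA (\<lambda>b x. p x b) D E"

lemma lie_matched_pair_iff:
  "lie_matched_pair s A (comm_bracket mA) t B (comm_bracket mB) E D \<longleftrightarrow> compatible"
proof -
  have "lie_matched_pair s A (comm_bracket mA) t B (comm_bracket mB) E D
    \<longleftrightarrow> lie_matched_pair_axioms A (comm_bracket mA) B (comm_bracket mB) E D"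
    unfolding lie_matched_pair_def
    using E_representation lsa_dual_pair.E_representation[OF swap] by simp
  also have "\<dots> \<longleftrightarrow> compatible"
    unfolding compatible_def compat_\<mu>_iff[symmetric] lsa_dual_pair.compat_\<mu>_iff[OF swap, symmetric]
      lie_matched_pair_axioms_def
    by blast
  finally show ?thesis .
qed

lemma lsa_matched_pair_iff:
  "lsa_matched_pair s A mA t B mB lA rA lB rB \<longleftrightarrow> compatible"
proof -
  have "lsa_matched_pair s A mA t B mB lA rA lB rB
    \<longleftrightarrow> lsa_matched_pair_axioms A mA B mB lA rA lB rB"
    unfolding lsa_matched_pair_def using bimodule lsa_dual_pair.bimodule[OF swap] by simp
  \<comment> \<open>Each symmetry occurs twice because two conditions reduce to it: those on
    \<open>rB\<close> and \<open>lA\<close> to the first, those on \<open>rA\<close> and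
    \<open>lB\<close> to the second. Folding the conjunction as a whole lets equal conjuncts become
    different conditions.\<close>
  also have "\<dots> \<longleftrightarrow> (mixed_symmetric \<and> mixed_symmetric) \<and>
      (lsa_dual_pair.mixed_symmetric B mB A mA (\<lambda>b x. p x b) D E \<and>
       lsa_dual_pair.mixed_symmetric B mB A mA (\<lambda>b x. p x b) D E)"
    unfolding conj_cong[OF compat_rB_iff compat_lA_iff, symmetric]
      conj_cong[OF lsa_dual_pair.compat_rB_iff[OF swap] lsa_dual_pair.compat_lA_iff[OF swap], symmetric]
      lsa_matched_pair_axioms_def
    by blast
  finally show ?thesis by (simp add: compatible_def)
qed

section \<open>The Jacobi identity and the symplectic form on the double\<close>

definition bracket_A :: "'a \<Rightarrow> 'b \<Rightarrow> 'a \<Rightarrow> 'b \<Rightarrow> 'a" where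
  "bracket_A x a y b = comm_bracket mA x y + D a y - D b x"

definition bracket_B :: "'a \<Rightarrow> 'b \<Rightarrow> 'a \<Rightarrow> 'b \<Rightarrow> 'b" where
  "bracket_B x a y b = comm_bracket mB a b + E x b - E y a"

text \<open>Exchanging \<open>A\<close> and \<open>B\<close> exchanges the two components of the
  bracket, so the \<open>B\<close>-component of the Jacobi identity is \<open>jacobi_A\<close> of
  the swapped pair.\<close>

lemma bracket_swap:
  "lsa_dual_pair.bracket_A mB E a x b y = bracket_B x a y b"
  "lsa_dual_pair.bracket_B mA D a x b y = bracket_A x a y b"
  by (simp_all add: bracket_A_def bracket_B_def
      lsa_dual_pair.bracket_A_def[OF swap] lsa_dual_pair.bracket_B_def[OF swap])

definition jacobi_A :: bool where
  "jacobi_A \<longleftrightarrow> (\<forall>x\<in>A. \<forall>y\<in>A. \<forall>z\<in>A. \<forall>a\<in>B. \<forall>b\<in>B. \<forall>c\<in>B.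
     bracket_A (bracket_A x a y b) (bracket_B x a y b) z c
     + bracket_A (bracket_A y b z c) (bracket_B y b z c) x a
     + bracket_A (bracket_A z c x a) (bracket_B z c x a) y b = 0)"

lemma jacobi_A_iff: "jacobi_A \<longleftrightarrow> mixed_symmetric"
proof -
  \<comment> \<open>\<open>C\<close> is the defect in the compatibility condition for \<mu>; the
    \<open>A\<close>-component of the Jacobi sum will be minus a cyclic sum of such defects.\<close>
  define C where "C x y a = D a (comm_bracket mA x y) - comm_bracket mA (D a x) y
      - comm_bracket mA x (D a y) + D (E x a) y - D (E y a) x" for x y a
  interpret L: lie_algebra s A "comm_bracket mA"
    by (rule A.sub_adjacent_lie_algebra)
  interpret M: lie_algebra t B "comm_bracket mB"
    by (rule B.sub_adjacent_lie_algebra)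
  note [simp] = bilinear_on_simps[OF L.bracket_bilinear A.space A.space]
    bilinear_on_simps[OF M.bracket_bilinear B.space B.space]
  have anti: "comm_bracket mA x y = - comm_bracket mA y x" for x y
    by (simp add: comm_bracket_def)
  have "bracket_A (bracket_A x a y b) (bracket_B x a y b) z c
     + bracket_A (bracket_A y b z c) (bracket_B y b z c) x a
     + bracket_A (bracket_A z c x a) (bracket_B z c x a) y b
     = - (C x y c + C y z a + C z x b)" (is "?J = _")
    if [simp]: "x \<in> A" "y \<in> A" "z \<in> A" "a \<in> B" "b \<in> B" "c \<in> B" for x y z a b c
  proof -
    \<comment> \<open>Once \<open>D\<close> of a bracket is expanded as a commutator of operators,
      every term involving \<open>B\<close> cancels and the Jacobi sum of \<open>A\<close>
      remains.\<close>
    have "?J + (C x y c + C y z a + C z x b) =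
      comm_bracket mA (comm_bracket mA x y) z + comm_bracket mA (comm_bracket mA y z) x
      + comm_bracket mA (comm_bracket mA z x) y"
      unfolding bracket_A_def bracket_B_def C_def
      by (simp add: lsa_dual_pair.E_bracket[OF swap] anti[of x "D _ _"] anti[of y "D _ _"]
          anti[of z "D _ _"] algebra_simps)
    then show ?thesis by (simp only: L.jacobi that eq_neg_iff_add_eq_0)
  qed
  note J = this
  have C0: "C x 0 a = 0" "C 0 y a = 0" if "x \<in> A" "y \<in> A" "a \<in> B" for x y a
    using that by (simp_all add: C_def)
  have "jacobi_A \<longleftrightarrow> (\<forall>x\<in>A. \<forall>y\<in>A. \<forall>z\<in>A. \<forall>a\<in>B. \<forall>b\<in>B. \<forall>c\<in>B. C x y c + C y z a + C z x b = 0)"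
    unfolding jacobi_A_def by (simp add: J del: minus_add_distrib)
  also have "\<dots> \<longleftrightarrow> (\<forall>a\<in>B. \<forall>x\<in>A. \<forall>y\<in>A. C x y a = 0)" (is "?l \<longleftrightarrow> ?r")
  proof
    show ?r if l: ?l
    proof (intro ballI)
      fix a x y assume "a \<in> B" "x \<in> A" "y \<in> A"
      \<comment> \<open>Putting zero for \<open>z\<close> and for the first two elements of
        \<open>B\<close> kills two of the three defects and isolates the one wanted.\<close>
      with l[rule_format, of x y 0 0 0 a] show "C x y a = 0" by (simp add: C0)
    qed
  qed simp
  finally show ?thesis by (simp only: C_def compat_\<mu>_iff)
qed

text \<open>Only the Jacobi identity imposes a condition. Nondegeneracy and the Lagrangian property
  come from the separating pairing, and closedness from the duality of \<open>E\<close> and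
  \<open>D\<close> with the left multiplications.\<close>

lemma parakaehler_iff:
  "parakaehler_lie_algebra (\<lambda>c (x, a). (s c x, t c a)) (A \<times> B)
     (\<lambda>(x, a) (y, b). (bracket_A x a y b, bracket_B x a y b))
     (A \<times> {0}) ({0} \<times> B) (\<lambda>(x, a) (y, b). p y a - p x b) \<longleftrightarrow> compatible"
  (is "parakaehler_lie_algebra ?s ?G ?br ?Gp ?Gm ?\<omega> \<longleftrightarrow> _")
proof -
  have vs: "vector_space ?s"
    by unfold_locales (auto simp: A.scale_right_distrib B.scale_right_distrib
        A.scale_left_distrib B.scale_left_distrib)
  interpret V: vector_space ?s by (rule vs)
  have sub: "V.subspace (U \<times> W)" if "A.subspace U" "B.subspace W" for U W
    using that by (auto simp: V.subspace_def A.subspace_def B.subspace_def zero_prod_def)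
  have vso: "vector_space_on ?s ?G"
    using sub[OF A.subspace_carrier B.subspace_carrier]
    by (intro vector_space_on.intro vs vector_space_on_axioms.intro)
  note defs = bracket_A_def bracket_B_def comm_bracket_def
  have bil: "bilinear_on ?s ?G ?s ?G ?s ?G ?br"
    by (rule bilinear_onI) (auto simp: defs algebra_simps A.scale_right_diff_distrib B.scale_right_diff_distrib)
  have J: "(\<forall>u\<in>?G. \<forall>v\<in>?G. \<forall>w\<in>?G. ?br (?br u v) w + ?br (?br v w) u + ?br (?br w u) v = 0)
    \<longleftrightarrow> compatible"
    unfolding compatible_def jacobi_A_iff[symmetric] lsa_dual_pair.jacobi_A_iff[OF swap, symmetric]
      jacobi_A_def lsa_dual_pair.jacobi_A_def[OF swap] bracket_swap
    by (auto simp: zero_prod_def)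
  have lie: "lie_algebra ?s ?G ?br \<longleftrightarrow> compatible"
    unfolding J[symmetric] lie_algebra_def lie_algebra_axioms_def
    using vso bil by (auto simp: defs zero_prod_def)
  have "parakaehler_lie_algebra_axioms ?s ?G ?br ?Gp ?Gm ?\<omega>"
  proof
    show "bilinear_on ?s ?G ?s ?G (*) UNIV ?\<omega>"
      by (rule bilinear_onI) (auto simp: algebra_simps)
    show "?\<omega> u v = - ?\<omega> v u" if "u \<in> ?G" "v \<in> ?G" for u v
      using that by auto
    show "u = 0" if "u \<in> ?G" and 0: "\<And>v. v \<in> ?G \<Longrightarrow> ?\<omega> u v = 0" for u
    proof -
      obtain x a where u: "u = (x, a)" "x \<in> A" "a \<in> B" using \<open>u \<in> ?G\<close> by auto
      have "x = 0" using 0[of "(0, b)" for b] u by (intro separating_A) auto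
      moreover have "a = 0" using 0[of "(y, 0)" for y] u by (intro separating_B) auto
      ultimately show ?thesis by (simp add: u zero_prod_def)
    qed
    \<comment> \<open>With \<open>E\<close> and \<open>D\<close> turned into products under
      \<open>p\<close>, each term cancels against a cyclic shift of another.\<close>
    show "?\<omega> (?br u v) w + ?\<omega> (?br v w) u + ?\<omega> (?br w u) v = 0"
      if "u \<in> ?G" "v \<in> ?G" "w \<in> ?G" for u v w
      using that by (auto simp: defs algebra_simps)
    show "lie_subalgebra ?s ?G ?br ?Gp" "lie_subalgebra ?s ?G ?br ?Gm"
      using sub[OF A.subspace_carrier B.subspace_single_0] sub[OF A.subspace_single_0 B.subspace_carrier]
      by (auto simp: lie_subalgebra_def defs)
    show "lagrangian ?G ?\<omega> ?Gp"
      unfolding lagrangian_def by (auto intro: separating_B)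
    show "lagrangian ?G ?\<omega> ?Gm"
      unfolding lagrangian_def by (auto intro: separating_A)
    show "?G = {u + v |u v. u \<in> ?Gp \<and> v \<in> ?Gm}"
      by (force intro: exI)
    show "?Gp \<inter> ?Gm = {0}"
      by (auto simp: zero_prod_def)
  qed
  then show ?thesis
    using lie by (simp add: parakaehler_lie_algebra_def)
qed

section \<open>The cocycle condition on the tensor square\<close>

lemma cocycle_iff:
  fixes tr :: "('a \<Rightarrow> 'a) \<Rightarrow> 'b \<Rightarrow> 'b"
  assumes tr_L: "\<And>x a. \<lbrakk>x \<in> A; a \<in> B\<rbrakk> \<Longrightarrow> tr (L_op mA x) a = - E x a"
    and tr_ad: "\<And>x a. \<lbrakk>x \<in> A; a \<in> B\<rbrakk> \<Longrightarrow> tr (ad_op mA x) a = - lA x a"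
    and tr_id: "\<And>a. a \<in> B \<Longrightarrow> tr id a = a"
  shows "lie_cocycle s A (comm_bracket mA) tensor_scale (tensor_square t B) (L_ad_action B tr mA)
      (\<lambda>x a b. if a \<in> B \<and> b \<in> B then p x (mB a b) else 0) \<longleftrightarrow> mixed_symmetric"
    (is "lie_cocycle _ _ _ _ ?V ?\<rho> ?\<delta> \<longleftrightarrow> _")
proof -
  interpret T: vector_space "tensor_scale :: 'f \<Rightarrow> ('b \<Rightarrow> 'b \<Rightarrow> 'f) \<Rightarrow> 'b \<Rightarrow> 'b \<Rightarrow> 'f"
    by (rule vector_space_tensor_scale)
  have V: "vector_space_on tensor_scale ?V"
    by unfold_locales
      (auto simp: T.subspace_def tensor_square_def bilinear_on_def linear_on_def tensor_scale_def
        algebra_simps)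
  have T_bil: "bilinear_on t B t B (*) UNIV T" if "T \<in> ?V" for T
    using that by (simp add: tensor_square_def)
  note T_simps = bilinear_on_simps(2-)[OF T_bil B.space B.space]
  note lA_simps = bilinear_on_simps[OF lA_bilinear A.space B.space]
  \<comment> \<open>A dual action is minus the transpose, whence the signs. \<open>tr\<close> enters
    only through its three assumed values, so one argument covers the plain transpose on the dual
    and the one transported from the bidual.\<close>
  have act: "?\<rho> x T a b = - T (E x a) b - T a (lA x b)"
    if "x \<in> A" "T \<in> ?V" "a \<in> B" "b \<in> B" for x T a b
    using that by (simp add: L_ad_action_def tensor_map_def tr_L tr_ad tr_id T_simps lA_simps)
  have act_0: "?\<rho> x T a b = 0" if "a \<notin> B \<or> b \<notin> B" for x T a b
    using that by (auto simp: L_ad_action_def tensor_map_def)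
  have closed: "?\<rho> x T \<in> ?V" if "x \<in> A" "T \<in> ?V" for x T
    unfolding tensor_square_def mem_Collect_eq
  proof (intro conjI bilinear_onI)
    show "\<forall>a b. a \<notin> B \<or> b \<notin> B \<longrightarrow> ?\<rho> x T a b = 0" by (simp add: act_0)
  qed (simp_all add: that act T_simps lA_simps algebra_simps)
  \<comment> \<open>Tensors vanish off the carrier, so agreement on \<open>B\<close> already makes
    them equal as functions.\<close>
  have tensor_ext: "S = S'" if "\<And>a b. \<lbrakk>a \<in> B; b \<in> B\<rbrakk> \<Longrightarrow> S a b = S' a b" "S \<in> ?V" "S' \<in> ?V" for S S'
  proof (intro ext)
    fix a b show "S a b = S' a b"
      using that by (cases "a \<in> B \<and> b \<in> B") (auto simp: tensor_square_def)
  qed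
  have tensor_eq_iff: "S = S' \<longleftrightarrow> (\<forall>a\<in>B. \<forall>b\<in>B. S a b = S' a b)" if "S \<in> ?V" "S' \<in> ?V" for S S'
    using tensor_ext[of S S'] that by blast
  note V_closed = vector_space_on.carrier_closed[OF V]
  have scale_apply: "tensor_scale c T a b = c * T a b" for c :: 'f and T and a b :: 'b
    by (simp add: tensor_scale_def)
  have bil: "bilinear_on s A tensor_scale ?V tensor_scale ?V ?\<rho>"
    by (rule bilinear_onI; (rule tensor_ext)?)
      (simp_all add: closed act V_closed T_simps lA_simps scale_apply algebra_simps)
  have rep: "lie_representation s A (comm_bracket mA) tensor_scale ?V ?\<rho>"
  proof (intro lie_representation.intro lie_representation_axioms.intro
      A.sub_adjacent_lie_algebra V bil)
    fix x y T assume [simp]: "x \<in> A" "y \<in> A" "T \<in> ?V"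
    have [simp]: "comm_bracket mA x y \<in> A" by (simp add: comm_bracket_def)
    \<comment> \<open>The two tensor factors are acted on by commuting operators, so the cross terms
      cancel and each factor contributes its own representation identity.\<close>
    show "?\<rho> (comm_bracket mA x y) T = ?\<rho> x (?\<rho> y T) - ?\<rho> y (?\<rho> x T)"
      by (rule tensor_ext) (simp_all add: closed act V_closed T_simps lA_simps E_bracket lA_bracket)
  qed
  have \<delta>: "linear_on s A tensor_scale ?V ?\<delta>"
    unfolding linear_on_def
  proof (intro conjI ballI allI)
    show "?\<delta> x \<in> ?V" if "x \<in> A" for x
      using that by (auto simp: tensor_square_def intro!: bilinear_onI)
  qed (simp_all add: fun_eq_iff tensor_scale_def)
  then have \<delta>_closed: "?\<delta> x \<in> ?V" if "x \<in> A" for x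
    using that by (simp add: linear_on_def)
  have "?\<delta> (comm_bracket mA x y) = ?\<rho> x (?\<delta> y) - ?\<rho> y (?\<delta> x)
    \<longleftrightarrow> (\<forall>a\<in>B. \<forall>b\<in>B. mixed x y a b = mixed y x a b)" if [simp]: "x \<in> A" "y \<in> A" for x y
  proof -
    have bracket_closed [simp]: "comm_bracket mA x y \<in> A" by (simp add: comm_bracket_def)
    have "?\<delta> (comm_bracket mA x y) = ?\<rho> x (?\<delta> y) - ?\<rho> y (?\<delta> x)
      \<longleftrightarrow> (\<forall>a\<in>B. \<forall>b\<in>B. ?\<delta> (comm_bracket mA x y) a b = (?\<rho> x (?\<delta> y) - ?\<rho> y (?\<delta> x)) a b)"
      by (intro tensor_eq_iff \<delta>_closed V_closed closed that bracket_closed)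
    \<comment> \<open>Splitting \<open>lA\<close> into \<open>E\<close> and \<open>rA\<close> and
      normalising by \<open>pairing_mixed\<close> turns the second tensor factor into the last two
      kinds of terms of \<open>mixed\<close>.\<close>
    also have "\<dots> \<longleftrightarrow> (\<forall>a\<in>B. \<forall>b\<in>B. mixed x y a b = mixed y x a b)"
      by (intro ball_cong refl)
        (auto simp: act \<delta>_closed lA_simps lA_eq mixed_def comm_bracket_def pairing_mixed algebra_simps)
    finally show ?thesis .
  qed
  then show ?thesis
    unfolding lie_cocycle_def lie_cocycle_axioms_def mixed_symmetric_def using rep \<delta> by (simp add: Ball_def)
qed

end

subsection \<open>The dual space\<close>

context finite_dimensional_vector_space
begin

lemma dual_rep_in_dual:
  assumes "bilinear_on scale UNIV scale UNIV scale UNIV m" "a \<in> dual scale"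
  shows "dual_rep m x a \<in> dual scale"
  using assms by (intro dualI) (simp_all add: dual_rep_def bilinear_on_def linear_on_def dualD[OF assms(2)])

text \<open>Finite dimension enters here: the dual action on the bidual comes back to the space
  itself, where it has the characterisation that \<open>lsa_dual_pair\<close> asks of
  \<open>D\<close>.\<close>

lemma pairing_bidual_rep:
  assumes \<rho>: "linear_on fun_scale (dual scale) fun_scale (dual scale) (\<rho> a)" and b: "b \<in> dual scale"
  shows "b (bidual_rep scale \<rho> a x) = - \<rho> a b x"
proof -
  have "linear_on fun_scale (dual scale) (*) UNIV (dual_rep \<rho> a (ev x))"
    using \<rho> by (auto simp: linear_on_def dual_rep_def ev_def fun_scale_def)
  from unbidual_works[OF this b] show ?thesis
    by (simp add: bidual_rep_def dual_rep_def ev_def)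
qed

end

section \<open>The evaluation pairing and the four conditions\<close>

theorem proposition4p2:
  fixes scale :: "'f::field \<Rightarrow> 'a::ab_group_add \<Rightarrow> 'a" and Basis :: "'a set"
    and mult :: "'a \<Rightarrow> 'a \<Rightarrow> 'a"
    and dmult :: "('a \<Rightarrow> 'f) \<Rightarrow> ('a \<Rightarrow> 'f) \<Rightarrow> 'a \<Rightarrow> 'f"
  assumes "finite_dimensional_vector_space scale Basis"
    and "left_symmetric_algebra scale UNIV mult"
    and "left_symmetric_algebra fun_scale (dual scale) dmult"
  shows "((parakaehler_lie_algebra (double_scale scale) (UNIV \<times> dual scale)
         (double_bracket scale mult dmult)
         (UNIV \<times> {0}) ({0} \<times> dual scale) double_form)
       \<longleftrightarrow>
        (lie_matched_pair
         scale UNIV (comm_bracket mult)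
         fun_scale (dual scale) (comm_bracket dmult)
         (dual_rep (L_op mult)) (bidual_rep scale (L_op dmult))))
     \<and>
       ((lie_matched_pair
         scale UNIV (comm_bracket mult)
         fun_scale (dual scale) (comm_bracket dmult)
         (dual_rep (L_op mult)) (bidual_rep scale (L_op dmult)))
       \<longleftrightarrow>
        (lsa_matched_pair
         scale UNIV mult
         fun_scale (dual scale) dmult
         (dual_rep (ad_op mult)) (- dual_rep (R_op mult))
         (bidual_rep scale (ad_op dmult)) (- bidual_rep scale (R_op dmult))))
     \<and>
       ((lsa_matched_pair
         scale UNIV mult
         fun_scale (dual scale) dmult
         (dual_rep (ad_op mult)) (- dual_rep (R_op mult))
         (bidual_rep scale (ad_op dmult)) (- bidual_rep scale (R_op dmult)))
       \<longleftrightarrow>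
        (left_symmetric_bialgebra scale mult dmult))"
proof -
  interpret V: finite_dimensional_vector_space scale Basis by fact
  interpret A: left_symmetric_algebra scale UNIV mult by fact
  interpret B: left_symmetric_algebra fun_scale "dual scale" dmult by fact
  have L: "linear_on fun_scale (dual scale) fun_scale (dual scale) (L_op dmult a)"
    and R: "linear_on fun_scale (dual scale) fun_scale (dual scale) (R_op dmult a)"
    if "a \<in> dual scale" for a
    using that by (auto simp: linear_on_def L_op_def R_op_def)
  have ad: "linear_on fun_scale (dual scale) fun_scale (dual scale) (ad_op dmult a)"
    if "a \<in> dual scale" for a
    using that by (auto simp: linear_on_def L_op_def R_op_def ad_op_def B.scale_right_diff_distrib)
  note bidual = V.pairing_bidual_rep[where \<rho> = "L_op dmult", OF L]
    V.pairing_bidual_rep[where \<rho> = "R_op dmult", OF R]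
    V.pairing_bidual_rep[where \<rho> = "ad_op dmult", OF ad]
  note ops = L_op_def R_op_def ad_op_def
  have pairing: "bilinear_on scale UNIV fun_scale (dual scale) (*) UNIV (\<lambda>x f. f x)"
    by (rule bilinear_onI) (simp_all add: V.dualD fun_scale_def)
  note pairing_simps = bilinear_on_simps(2-)[OF pairing A.space B.space]
  interpret P: lsa_dual_pair scale UNIV mult fun_scale "dual scale" dmult "\<lambda>x f. f x"
    "dual_rep (L_op mult)" "dual_rep (ad_op mult)" "- dual_rep (R_op mult)"
    "bidual_rep scale (L_op dmult)" "bidual_rep scale (ad_op dmult)"
    "- bidual_rep scale (R_op dmult)"
  proof
    show "bilinear_on scale UNIV fun_scale (dual scale) (*) UNIV (\<lambda>x f. f x)"
      by (rule pairing)
    show "dual_rep (L_op mult) x a \<in> dual scale" if "a \<in> dual scale" for x a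
      using that A.mult_bilinear by (intro V.dual_rep_in_dual) (simp_all add: bilinear_on_def ops)
    show "(- dual_rep (R_op mult)) x a \<in> dual scale" if "a \<in> dual scale" for x a
    proof -
      have "- dual_rep (R_op mult) x a \<in> dual scale"
        using that A.mult_bilinear
        by (intro B.carrier_closed V.dual_rep_in_dual) (simp_all add: bilinear_on_def ops)
      then show ?thesis by (simp add: fun_Compl_def)
    qed
    show "x = y" if "\<And>b. b \<in> dual scale \<Longrightarrow> b x = b y" for x y
      using that by (rule V.dual_separates)
    show "bidual_rep scale (ad_op dmult) a x
        = bidual_rep scale (L_op dmult) a x + (- bidual_rep scale (R_op dmult)) a x"
      if "a \<in> dual scale" for x a
      \<comment> \<open>The transported operators are given by a definite description, so ad* = L* -
        R* is checked after applying functionals; on the dual side it holds pointwise.\<close>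
      by (rule V.dual_separates) (use that in \<open>simp add: bidual pairing_simps ops\<close>)
    show "dual_rep (ad_op mult) x a = dual_rep (L_op mult) x a + (- dual_rep (R_op mult)) x a"
      if "a \<in> dual scale" for x a
      using that by (simp add: fun_eq_iff dual_rep_def pairing_simps ops)
    show "bidual_rep scale (L_op dmult) a x \<in> UNIV" "(- bidual_rep scale (R_op dmult)) a x \<in> UNIV"
      for a x by (rule UNIV_I)+
    show "a = b" if "\<And>x. x \<in> UNIV \<Longrightarrow> a x = b x" for a b :: "'a \<Rightarrow> 'f"
      using that by auto
    show "dual_rep (L_op mult) x a y = - a (mult x y)" "(- dual_rep (R_op mult)) x a y = a (mult y x)"
      for x y a by (simp_all add: dual_rep_def ops)
    show "b (bidual_rep scale (L_op dmult) a x) = - dmult a b x"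
      if "a \<in> dual scale" "b \<in> dual scale" for a b x
      using that by (simp add: bidual ops)
    show "b ((- bidual_rep scale (R_op dmult)) a x) = dmult b a x"
      if "a \<in> dual scale" "b \<in> dual scale" for a b x
      using that by (simp add: bidual pairing_simps ops)
  qed
  have bracket: "double_bracket scale mult dmult
      = (\<lambda>(x, a) (y, b). (P.bracket_A x a y b, P.bracket_B x a y b))"
    by (simp add: double_bracket_def P.bracket_A_def P.bracket_B_def)
  have 1: "parakaehler_lie_algebra (double_scale scale) (UNIV \<times> dual scale)
      (double_bracket scale mult dmult) (UNIV \<times> {0}) ({0} \<times> dual scale) double_form \<longleftrightarrow> P.compatible"
    using P.parakaehler_iff unfolding bracket double_scale_def double_form_def .
  have \<alpha>: "lie_cocycle scale UNIV (comm_bracket mult)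
      tensor_scale (tensor_square fun_scale (dual scale))
      (L_ad_action (dual scale) transpose_map mult) (comult scale dmult) \<longleftrightarrow> P.mixed_symmetric"
    unfolding comult_def
    by (rule P.cocycle_iff) (simp_all add: transpose_map_def dual_rep_def fun_eq_iff)
  \<comment> \<open>The vacuous membership tests in \<open>UNIV\<close> match the general shape of
    \<open>cocycle_iff\<close>; they are simplified away to reach
    \<open>dual_comult\<close>.\<close>
  have "lie_cocycle fun_scale (dual scale) (comm_bracket dmult)
      tensor_scale (tensor_square scale UNIV)
      (L_ad_action UNIV (bidual_transp scale) dmult)
      (\<lambda>f x y. if x \<in> UNIV \<and> y \<in> UNIV then f (mult x y) else 0)
    \<longleftrightarrow> lsa_dual_pair.mixed_symmetric (dual scale) dmult UNIV mult (\<lambda>f x. f x)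
      (bidual_rep scale (L_op dmult)) (dual_rep (L_op mult))"
  proof (rule lsa_dual_pair.cocycle_iff[OF P.swap])
    have id: "linear_on fun_scale (dual scale) fun_scale (dual scale) id"
      by (simp add: linear_on_def)
    show "bidual_transp scale id x = x" for x
      by (rule V.dual_separates) (simp add: V.bidual_transp_works id)
    show "bidual_transp scale (L_op dmult a) x = - bidual_rep scale (L_op dmult) a x"
      if "a \<in> dual scale" for a x
      by (rule V.dual_separates)
        (simp add: V.bidual_transp_works L bidual pairing_simps that ops)
    show "bidual_transp scale (ad_op dmult a) x = - bidual_rep scale (ad_op dmult) a x"
      if "a \<in> dual scale" for a x
      by (rule V.dual_separates)
        (simp add: V.bidual_transp_works ad bidual pairing_simps that ops)
  qed
  then have \<beta>: "lie_cocycle fun_scale (dual scale) (comm_bracket dmult)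
      tensor_scale (tensor_square scale UNIV)
      (L_ad_action UNIV (bidual_transp scale) dmult) (dual_comult mult)
    \<longleftrightarrow> lsa_dual_pair.mixed_symmetric (dual scale) dmult UNIV mult (\<lambda>f x. f x)
      (bidual_rep scale (L_op dmult)) (dual_rep (L_op mult))"
    by (simp add: dual_comult_def[abs_def])
  have "left_symmetric_bialgebra scale mult dmult \<longleftrightarrow> P.compatible"
    unfolding left_symmetric_bialgebra_def \<alpha> \<beta> P.compatible_def
    using assms(2,3) by simp
  then show ?thesis
    unfolding 1 P.lie_matched_pair_iff P.lsa_matched_pair_iff by blast
qed

end
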